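(* Let $k$ be an infinite field, $G$ a finite group, and $V$ a cyclic left $kG$-module. Then the set of $v\in \operatorname{Gens}(V)$ such that $\operatorname{Sym}(G,v)\neq \operatorname{Sym}(G,V)$ is Zariski-closed in $\operatorname{Gens}(V)$ (i.e. relatively closed with respect to the Zariski topology of $V$).
   Context: For a finite group $G$, a field $k$ and a left $kG$-module $V$, let $\operatorname{Gens}(V)=\{v\in V : V=kGv\}$, where $kGv$ is the $k$-linear span of the orbit $Gv$. $V$ is called cyclic if $\operatorname{Gens}(V)\neq\emptyset$ (then $V$ is finite-dimensional over $k$). For $v\in V$, $\operatorname{Sym}(G,v)$ is the set of all permutations $\pi\in\operatorname{Sym}(G)$ (the symmetric group on the set $G$) for which there is $A\in \operatorname{GL}(V)$ with $A(gv)=\pi(g)v$ for all $g\in G$. For $V$ cyclic, $\operatorname{Sym}(G,V)=\bigcap_{v\in\operatorname{Gens}(V)}\operatorname{Sym}(G,v)$. The Zariski topology on a finite-dimensional $k$-space $V\cong k^d$ has as closed sets the zero sets of families of polynomials in $k[X_1,\dots,X_d]$ (independent of the choice of basis). *)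

theory Defs
  imports
    "HOL-Analysis.Abstract_Topology"
    "HOL-Algebra.Group_Action"
    "HOL-Combinatorics.Permutations"
    "HOL-Library.Poly_Mapping"
begin

section \<open>Multivariate polynomials\<close>

text \<open>A monomial is its exponent vector and a polynomial maps monomials to coefficients.\<close>

type_synonym ('i, 'a) mpolynomial = "('i \<Rightarrow>\<^sub>0 nat) \<Rightarrow>\<^sub>0 'a"

definition mpoly_vars :: "('i, 'a::zero) mpolynomial \<Rightarrow> 'i set" where
  "mpoly_vars p = (\<Union>m\<in>Poly_Mapping.keys p. Poly_Mapping.keys m)"

definition monomial_eval :: "('i \<Rightarrow>\<^sub>0 nat) \<Rightarrow> ('i \<Rightarrow> 'a::comm_semiring_1) \<Rightarrow> 'a" where
  "monomial_eval m x = (\<Prod>i\<in>Poly_Mapping.keys m. x i ^ Poly_Mapping.lookup m i)"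

definition mpoly_eval :: "('i, 'a::comm_semiring_1) mpolynomial \<Rightarrow> ('i \<Rightarrow> 'a) \<Rightarrow> 'a" where
  "mpoly_eval p x = (\<Sum>m\<in>Poly_Mapping.keys p. Poly_Mapping.lookup p m * monomial_eval m x)"

lemma monomial_eval_superset:
  assumes "finite S" "Poly_Mapping.keys m \<subseteq> S"
  shows "monomial_eval m x = (\<Prod>i\<in>S. x i ^ Poly_Mapping.lookup m i)"
  unfolding monomial_eval_def
  by (rule prod.mono_neutral_left) (use assms in \<open>auto simp: in_keys_iff\<close>)

lemma monomial_eval_0: "monomial_eval 0 x = 1"
  by (simp add: monomial_eval_def)

lemma monomial_eval_var: "monomial_eval (Poly_Mapping.single i 1) x = x i"
  by (simp add: monomial_eval_def)

lemma monomial_eval_add: "monomial_eval (m + n) x = monomial_eval m x * monomial_eval n x"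
proof -
  let ?S = "Poly_Mapping.keys m \<union> Poly_Mapping.keys n"
  have "Poly_Mapping.keys (m + n) \<subseteq> ?S" by (rule Poly_Mapping.keys_add)
  then show ?thesis
    by (simp add: monomial_eval_superset[of ?S] lookup_add power_add prod.distrib)
qed

lemma mpoly_eval_superset:
  assumes "finite S" "Poly_Mapping.keys p \<subseteq> S"
  shows "mpoly_eval p x = (\<Sum>m\<in>S. Poly_Mapping.lookup p m * monomial_eval m x)"
  unfolding mpoly_eval_def
  by (rule sum.mono_neutral_left) (use assms in \<open>auto simp: in_keys_iff\<close>)

lemma mpoly_eval_add: "mpoly_eval (p + q) x = mpoly_eval p x + mpoly_eval q x"
proof -
  let ?S = "Poly_Mapping.keys p \<union> Poly_Mapping.keys q"
  have "Poly_Mapping.keys (p + q) \<subseteq> ?S" by (rule Poly_Mapping.keys_add)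
  then show ?thesis
    by (simp add: mpoly_eval_superset[of ?S] lookup_add distrib_right sum.distrib)
qed

lemma mpoly_eval_single: "mpoly_eval (Poly_Mapping.single m c) x = c * monomial_eval m x"
  by (simp add: mpoly_eval_superset[of "{m}"])


section \<open>The Zariski topology of a finite-dimensional vector space\<close>

text \<open>A separate locale because names added to \<^locale>\<open>vector_space\<close> itself are shadowed by
  their interpretation for real vector spaces.\<close>

locale zariski_space = vector_space scale
  for scale :: "'a::field \<Rightarrow> 'b::ab_group_add \<Rightarrow> 'b"
begin

text \<open>The coordinates of a vector, and hence the variables of the polynomials, are indexed by the
  vectors of a finite basis. That the basis does not matter is
  \<open>zariski_closed_iff_basis\<close> below. In infinite dimension no set is \<open>zariski_closed\<close>, and
  \<open>zariski_topology\<close> is meaningless.\<close>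

definition zariski_closed :: "'b set \<Rightarrow> bool" where
  "zariski_closed C \<longleftrightarrow>
    (\<exists>B (P :: ('b, 'a) mpolynomial set).
      finite B \<and> independent B \<and> span B = UNIV \<and> (\<forall>p\<in>P. mpoly_vars p \<subseteq> B) \<and>
      C = {v. \<forall>p\<in>P. mpoly_eval p (representation B v) = 0})"

definition zariski_topology :: "'b topology" where
  "zariski_topology = topology (\<lambda>U. zariski_closed (- U))"

definition polyfuns :: "'b set \<Rightarrow> ('b \<Rightarrow> 'a) set" where
  "polyfuns B = {\<lambda>v. mpoly_eval p (representation B v) | p. mpoly_vars p \<subseteq> B}"

lemma polyfuns_subsetE:
  assumes "F \<subseteq> polyfuns B"
  obtains P where "\<forall>p\<in>P. mpoly_vars p \<subseteq> B"
    and "F = (\<lambda>p v. mpoly_eval p (representation B v)) ` P"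
proof -
  have "polyfuns B = (\<lambda>p v. mpoly_eval p (representation B v)) ` {p. mpoly_vars p \<subseteq> B}"
    unfolding polyfuns_def by blast
  with assms have "F \<subseteq> (\<lambda>p v. mpoly_eval p (representation B v)) ` {p. mpoly_vars p \<subseteq> B}"
    by (simp only:)
  then obtain P where "P \<subseteq> {p. mpoly_vars p \<subseteq> B}"
    "F = (\<lambda>p v. mpoly_eval p (representation B v)) ` P"
    by (rule subset_imageE)
  then show ?thesis using that[of P] by blast
qed

lemma polyfuns_monomial:
  assumes "Poly_Mapping.keys m \<subseteq> B"
  shows "(\<lambda>v. c * monomial_eval m (representation B v)) \<in> polyfuns B"
proof -
  have "mpoly_vars (Poly_Mapping.single m c) \<subseteq> B"
    using assms by (auto simp: mpoly_vars_def split: if_splits)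
  moreover have "(\<lambda>v. c * monomial_eval m (representation B v)) =
      (\<lambda>v. mpoly_eval (Poly_Mapping.single m c) (representation B v))"
    by (simp add: mpoly_eval_single)
  ultimately show ?thesis unfolding polyfuns_def by (intro CollectI exI conjI)
qed

lemma polyfuns_const: "(\<lambda>v. c) \<in> polyfuns B"
  using polyfuns_monomial[of 0 B c] by (simp add: monomial_eval_0)

lemma polyfuns_coord: "b \<in> B \<Longrightarrow> (\<lambda>v. representation B v b) \<in> polyfuns B"
  using polyfuns_monomial[of "Poly_Mapping.single b 1" B 1]
  by (simp add: monomial_eval_var del: One_nat_def)

lemma polyfuns_add:
  assumes "f \<in> polyfuns B" "g \<in> polyfuns B"
  shows "(\<lambda>v. f v + g v) \<in> polyfuns B"
proof -
  obtain p q where pq: "f = (\<lambda>v. mpoly_eval p (representation B v))" "mpoly_vars p \<subseteq> B"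
    "g = (\<lambda>v. mpoly_eval q (representation B v))" "mpoly_vars q \<subseteq> B"
    using assms by (auto simp: polyfuns_def)
  have "mpoly_vars (p + q) \<subseteq> B"
    using pq(2,4) Poly_Mapping.keys_add[of p q] unfolding mpoly_vars_def by blast
  moreover have "(\<lambda>v. f v + g v) = (\<lambda>v. mpoly_eval (p + q) (representation B v))"
    by (simp add: pq(1,3) mpoly_eval_add)
  ultimately show ?thesis unfolding polyfuns_def by (intro CollectI exI conjI)
qed

lemma polyfuns_sum:
  "(\<And>i. i \<in> I \<Longrightarrow> f i \<in> polyfuns B) \<Longrightarrow> (\<lambda>v. \<Sum>i\<in>I. f i v) \<in> polyfuns B"
  by (induction I rule: infinite_finite_induct) (auto intro: polyfuns_const polyfuns_add)

lemma polyfuns_mult: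
  assumes "f \<in> polyfuns B" "g \<in> polyfuns B"
  shows "(\<lambda>v. f v * g v) \<in> polyfuns B"
proof -
  obtain p q where pq: "f = (\<lambda>v. mpoly_eval p (representation B v))" "mpoly_vars p \<subseteq> B"
    "g = (\<lambda>v. mpoly_eval q (representation B v))" "mpoly_vars q \<subseteq> B"
    using assms by (auto simp: polyfuns_def)
  have "(\<lambda>v. f v * g v) = (\<lambda>v. \<Sum>m\<in>Poly_Mapping.keys p. \<Sum>n\<in>Poly_Mapping.keys q.
      (Poly_Mapping.lookup p m * Poly_Mapping.lookup q n) * monomial_eval (m + n) (representation B v))"
    by (simp add: pq(1,3) mpoly_eval_def sum_product monomial_eval_add mult_ac)
  moreover have "\<dots> \<in> polyfuns B"
  proof (intro polyfuns_sum polyfuns_monomial)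
    fix m n assume "m \<in> Poly_Mapping.keys p" "n \<in> Poly_Mapping.keys q"
    then show "Poly_Mapping.keys (m + n) \<subseteq> B"
      using pq(2,4) Poly_Mapping.keys_add[of m n] unfolding mpoly_vars_def by blast
  qed
  ultimately show ?thesis by simp
qed

lemma polyfuns_prod:
  "(\<And>i. i \<in> I \<Longrightarrow> f i \<in> polyfuns B) \<Longrightarrow> (\<lambda>v. \<Prod>i\<in>I. f i v) \<in> polyfuns B"
  by (induction I rule: infinite_finite_induct) (auto intro: polyfuns_const polyfuns_mult)

lemma polyfuns_power: "f \<in> polyfuns B \<Longrightarrow> (\<lambda>v. f v ^ n) \<in> polyfuns B"
  by (induction n) (auto intro: polyfuns_const polyfuns_mult)

lemma polyfuns_coord_change:
  assumes B: "independent B" "span B = UNIV"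
    and C: "finite C" "independent C" "span C = UNIV"
  shows "(\<lambda>v. representation B v b) \<in> polyfuns C"
proof -
  have "representation B v b = (\<Sum>c\<in>C. representation C v c * representation B c b)" for v
  proof -
    have "v = (\<Sum>c\<in>C. scale (representation C v c) c)"
      by (rule sum_representation_eq[symmetric]) (use C in auto)
    then have "representation B v b = representation B (\<Sum>c\<in>C. scale (representation C v c) c) b"
      by (rule arg_cong[where f = "\<lambda>u. representation B u b"])
    also have "\<dots> = (\<Sum>c\<in>C. representation C v c * representation B c b)"
      using B by (simp add: representation_sum representation_scale)
    finally show ?thesis .
  qed
  then have eq: "(\<lambda>v. representation B v b) =
      (\<lambda>v. \<Sum>c\<in>C. representation C v c * representation B c b)"
    by (rule ext)
  show ?thesis
    by (subst eq) (intro polyfuns_sum polyfuns_mult polyfuns_coord polyfuns_const)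
qed

lemma polyfuns_basis_change:
  assumes "independent B" "span B = UNIV" "finite C" "independent C" "span C = UNIV"
  shows "polyfuns B \<subseteq> polyfuns C"
proof
  fix f assume "f \<in> polyfuns B"
  then obtain p :: "('b, 'a) mpolynomial" where "f = (\<lambda>v. mpoly_eval p (representation B v))"
    unfolding polyfuns_def by blast
  then show "f \<in> polyfuns C"
    unfolding mpoly_eval_def monomial_eval_def
    by (simp add: polyfuns_sum polyfuns_mult polyfuns_prod polyfuns_power polyfuns_const
        polyfuns_coord_change[OF assms])
qed

lemma zariski_closed_iff_polyfuns:
  assumes B: "finite B" "independent B" "span B = UNIV"
  shows "zariski_closed C \<longleftrightarrow> (\<exists>F \<subseteq> polyfuns B. C = {v. \<forall>f\<in>F. f v = 0})"
proof
  assume "zariski_closed C"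
  then obtain B' and P :: "('b, 'a) mpolynomial set"
    where B': "independent B'" "span B' = UNIV" and P: "\<forall>p\<in>P. mpoly_vars p \<subseteq> B'"
      and C: "C = {v. \<forall>p\<in>P. mpoly_eval p (representation B' v) = 0}"
    unfolding zariski_closed_def by blast
  let ?F = "(\<lambda>p v. mpoly_eval p (representation B' v)) ` P"
  have "?F \<subseteq> polyfuns B'" using P by (auto simp: polyfuns_def)
  also have "\<dots> \<subseteq> polyfuns B" by (rule polyfuns_basis_change[OF B' B])
  finally show "\<exists>F \<subseteq> polyfuns B. C = {v. \<forall>f\<in>F. f v = 0}"
    using C by (intro exI[of _ ?F]) auto
next
  assume "\<exists>F \<subseteq> polyfuns B. C = {v. \<forall>f\<in>F. f v = 0}"
  then obtain F where F: "F \<subseteq> polyfuns B" "C = {v. \<forall>f\<in>F. f v = 0}" by blast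
  obtain P where P: "\<forall>p\<in>P. mpoly_vars p \<subseteq> B"
    and FP: "F = (\<lambda>p v. mpoly_eval p (representation B v)) ` P"
    using polyfuns_subsetE[OF F(1)] by blast
  have "C = {v. \<forall>p\<in>P. mpoly_eval p (representation B v) = 0}"
    unfolding F(2) FP by simp
  then show "zariski_closed C"
    unfolding zariski_closed_def using B P by blast
qed

lemma zariski_closed_iff_basis:
  assumes B: "finite B" "independent B" "span B = UNIV"
  shows "zariski_closed C \<longleftrightarrow>
    (\<exists>P :: ('b, 'a) mpolynomial set. (\<forall>p\<in>P. mpoly_vars p \<subseteq> B) \<and>
      C = {v. \<forall>p\<in>P. mpoly_eval p (representation B v) = 0})"
    (is "_ \<longleftrightarrow> ?R")
proof
  assume "zariski_closed C"
  then obtain F where F: "F \<subseteq> polyfuns B" "C = {v. \<forall>f\<in>F. f v = 0}"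
    unfolding zariski_closed_iff_polyfuns[OF B] by blast
  obtain P where P: "\<forall>p\<in>P. mpoly_vars p \<subseteq> B"
    and FP: "F = (\<lambda>p v. mpoly_eval p (representation B v)) ` P"
    using polyfuns_subsetE[OF F(1)] by blast
  have "C = {v. \<forall>p\<in>P. mpoly_eval p (representation B v) = 0}"
    unfolding F(2) FP by simp
  with P show ?R by blast
next
  assume ?R
  then show "zariski_closed C" unfolding zariski_closed_def using B by blast
qed

lemma zariski_closed_Un:
  assumes B: "finite B" "independent B" "span B = UNIV"
    and "zariski_closed C" "zariski_closed D"
  shows "zariski_closed (C \<union> D)"
proof -
  obtain F H where F: "F \<subseteq> polyfuns B" "C = {v. \<forall>f\<in>F. f v = 0}"
    and H: "H \<subseteq> polyfuns B" "D = {v. \<forall>f\<in>H. f v = 0}"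
    using assms(4,5) unfolding zariski_closed_iff_polyfuns[OF B] by blast
  let ?K = "(\<lambda>(f, h) v. f v * h v) ` (F \<times> H)"
  have "?K \<subseteq> polyfuns B" using F H by (auto intro: polyfuns_mult)
  moreover have "C \<union> D = {v. \<forall>f\<in>?K. f v = 0}" using F H by auto
  ultimately show ?thesis unfolding zariski_closed_iff_polyfuns[OF B] by blast
qed

lemma zariski_closed_Inter:
  assumes B: "finite B" "independent B" "span B = UNIV"
    and "\<And>C. C \<in> \<C> \<Longrightarrow> zariski_closed C"
  shows "zariski_closed (\<Inter>\<C>)"
proof -
  let ?F = "\<Union>C\<in>\<C>. {f \<in> polyfuns B. \<forall>v\<in>C. f v = 0}"
  have "v \<in> C" if C: "C \<in> \<C>" and v: "\<forall>f\<in>?F. f v = 0" for v C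
  proof -
    obtain H where H: "H \<subseteq> polyfuns B" "C = {v. \<forall>f\<in>H. f v = 0}"
      using assms(4)[OF C] unfolding zariski_closed_iff_polyfuns[OF B] by blast
    have "H \<subseteq> ?F" using H C by auto
    then have "\<forall>f\<in>H. f v = 0" using v by blast
    then show ?thesis by (simp add: H(2))
  qed
  then have "\<Inter>\<C> = {v. \<forall>f\<in>?F. f v = 0}" by blast
  moreover have "?F \<subseteq> polyfuns B" by blast
  ultimately show ?thesis unfolding zariski_closed_iff_polyfuns[OF B] by blast
qed

lemma istopology_zariski:
  assumes B: "finite B" "independent B" "span B = UNIV"
  shows "istopology (\<lambda>U. zariski_closed (- U))"
  unfolding istopology_def
proof (intro conjI allI impI)
  fix S T assume "zariski_closed (- S)" "zariski_closed (- T)"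
  then show "zariski_closed (- (S \<inter> T))"
    using zariski_closed_Un[OF B, of "- S" "- T"] by (simp add: Compl_Int)
next
  fix \<K> assume "\<forall>K\<in>\<K>. zariski_closed (- K)"
  then have "zariski_closed (\<Inter>(uminus ` \<K>))"
    by (intro zariski_closed_Inter[OF B]) auto
  then show "zariski_closed (- \<Union>\<K>)" by (simp add: uminus_Sup)
qed

lemma openin_zariski_topology:
  assumes "finite B" "independent B" "span B = UNIV"
  shows "openin zariski_topology U \<longleftrightarrow> zariski_closed (- U)"
  unfolding zariski_topology_def using istopology_zariski[OF assms] by simp

lemma topspace_zariski_topology:
  assumes B: "finite B" "independent B" "span B = UNIV"
  shows "topspace zariski_topology = UNIV"
proof -
  have "zariski_closed {}"
    unfolding zariski_closed_iff_polyfuns[OF B]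
    by (intro exI[of _ "{\<lambda>v. 1}"]) (simp add: polyfuns_const)
  then have "openin zariski_topology UNIV"
    by (simp add: openin_zariski_topology[OF B])
  then show ?thesis using openin_subset by blast
qed

lemma closedin_zariski_topology:
  assumes B: "finite B" "independent B" "span B = UNIV"
  shows "closedin zariski_topology C \<longleftrightarrow> zariski_closed C"
  by (simp add: closedin_def topspace_zariski_topology[OF B] openin_zariski_topology[OF B]
      Compl_eq_Diff_UNIV[symmetric])

end


section \<open>Modules over the group algebra\<close>

text \<open>A left module over the group algebra of \<open>G\<close> is given as a vector space with an action of \<open>G\<close>
  by linear maps. The unit law is part of \<^locale>\<open>group_action\<close>, as \<open>BijGroup\<close> is a group.\<close>

locale group_module = zariski_space scale + group_action G UNIV act
  for G :: "('g, 'm) monoid_scheme" (structure)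
    and scale :: "'k::field \<Rightarrow> 'v::ab_group_add \<Rightarrow> 'v"
    and act :: "'g \<Rightarrow> 'v \<Rightarrow> 'v" +
  assumes linear_act: "g \<in> carrier G \<Longrightarrow> Vector_Spaces.linear scale scale (act g)"
begin

definition Gens :: "'v set" where
  "Gens = {v. span (orbit G act v) = UNIV}"

definition cyclic :: bool where
  "cyclic \<longleftrightarrow> Gens \<noteq> {}"

definition GL :: "('v \<Rightarrow> 'v) set" where
  "GL = {A. Vector_Spaces.linear scale scale A \<and> bij A}"

definition Sym_vec :: "'v \<Rightarrow> ('g \<Rightarrow> 'g) set" where
  "Sym_vec v = {\<pi>. \<pi> permutes carrier G \<and> (\<exists>A\<in>GL. \<forall>g\<in>carrier G. A (act g v) = act (\<pi> g) v)}"

text \<open>Only meaningful for cyclic modules.\<close>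

definition Sym_mod :: "('g \<Rightarrow> 'g) set" where
  "Sym_mod = (\<Inter>v\<in>Gens. Sym_vec v)"

end

end

theory Submission
  imports Defs "Jordan_Normal_Form.Determinant"
begin

text \<open>For a generator \<open>v\<close>, a permutation \<open>\<pi>\<close> lies in \<open>Sym(G, v)\<close> iff every linear relation between
  the vectors \<open>g v\<close> also holds between the vectors \<open>\<pi>(g) v\<close>: the resulting endomorphism is onto,
  hence bijective. All relations follow from those that express each \<open>g v\<close> in a basis
  \<open>s\<^sub>1 v, \<dots>, s\<^sub>d v\<close>, and Cramer's rule writes these with coefficients that are polynomials
  in \<open>v\<close>. So for each \<open>\<pi>\<close> the condition \<open>\<pi> \<in> Sym(G, v)\<close> is closed in \<open>Gens(V)\<close>, and the
  set in question is the union of these closed sets over the finitely many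
  \<open>\<pi> \<notin> Sym(G, V)\<close>.\<close>

section \<open>Polynomial dependence of determinants and adjugates on the entries\<close>

context zariski_space
begin

text \<open>The Leibniz formula builds the determinant from the entries by finite sums and products
  only.\<close>

lemma polyfuns_det:
  assumes dim: "\<And>v. M v \<in> carrier_mat n n"
    and entry: "\<And>i j. i < n \<Longrightarrow> j < n \<Longrightarrow> (\<lambda>v. M v $$ (i, j)) \<in> polyfuns B"
  shows "(\<lambda>v. det (M v)) \<in> polyfuns B"
proof -
  have "(\<lambda>v. det (M v)) = (\<lambda>v. \<Sum>p\<in>{p. p permutes {0..<n}}.
      signof p * (\<Prod>i = 0..<n. M v $$ (i, p i)))"
    by (rule ext) (rule det_def'[OF dim])
  also have "\<dots> \<in> polyfuns B"
  proof (intro polyfuns_sum polyfuns_mult polyfuns_const polyfuns_prod entry)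
    fix p i assume "p \<in> {p. p permutes {0..<n}}" "i \<in> {0..<n}"
    then show "i < n" "p i < n" using permutes_in_image[of p "{0..<n}" i] by auto
  qed
  finally show ?thesis .
qed

text \<open>Up to sign, an entry of the adjugate is a minor, hence a determinant of entries of
  \<open>M v\<close>.\<close>

lemma polyfuns_adj_mat:
  assumes dim: "\<And>v. M v \<in> carrier_mat n n"
    and entry: "\<And>i j. i < n \<Longrightarrow> j < n \<Longrightarrow> (\<lambda>v. M v $$ (i, j)) \<in> polyfuns B"
    and ij: "i < n" "j < n"
  shows "(\<lambda>v. adj_mat (M v) $$ (i, j)) \<in> polyfuns B"
proof -
  have dims: "dim_row (M v) = n" "dim_col (M v) = n" for v
    using dim[of v] by auto
  have "(\<lambda>v. adj_mat (M v) $$ (i, j)) = (\<lambda>v. (- 1) ^ (j + i) * det (mat_delete (M v) j i))"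
    using ij by (simp add: adj_mat_def dims cofactor_def)
  also have "\<dots> \<in> polyfuns B"
  proof (intro polyfuns_mult polyfuns_const polyfuns_det)
    show "mat_delete (M v) j i \<in> carrier_mat (n - 1) (n - 1)" for v
      by (rule mat_delete_carrier[OF dim])
    show "(\<lambda>v. mat_delete (M v) j i $$ (k, l)) \<in> polyfuns B" if "k < n - 1" "l < n - 1" for k l
      using that by (simp add: mat_delete_def dims) (intro conjI impI entry; linarith)
  qed
  finally show ?thesis .
qed

end

section \<open>Cramer's rule in coordinates\<close>

locale ordered_basis_space = zariski_space scale
  for scale :: "'a::field \<Rightarrow> 'b::ab_group_add \<Rightarrow> 'b" +
  fixes bs :: "'b list"
  assumes distinct_bs: "distinct bs"
    and independent_bs: "independent (set bs)"
    and span_bs: "span (set bs) = UNIV"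
begin

abbreviation coord :: "'b \<Rightarrow> 'b \<Rightarrow> 'a" where
  "coord \<equiv> representation (set bs)"

definition coord_mat :: "(nat \<Rightarrow> 'b) \<Rightarrow> 'a mat" where
  "coord_mat w = mat (length bs) (length bs) (\<lambda>(i, j). coord (w j) (bs ! i))"

text \<open>These are the numerators in Cramer's rule. Leaving out the division by the determinant
  keeps them polynomial and defined for dependent tuples as well.\<close>

definition cramer_coeff :: "(nat \<Rightarrow> 'b) \<Rightarrow> 'b \<Rightarrow> nat \<Rightarrow> 'a" where
  "cramer_coeff w u j =
    (\<Sum>k<length bs. adj_mat (coord_mat w) $$ (j, k) * coord u (bs ! k))"

lemma coord_eqI:
  assumes "\<And>b. b \<in> set bs \<Longrightarrow> coord x b = coord y b"
  shows "x = y"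
proof -
  have "z = (\<Sum>b\<in>set bs. scale (coord z b) b)" for z
    by (rule sum_representation_eq[symmetric]) (use independent_bs span_bs in auto)
  then show ?thesis
    using assms by (metis (no_types, lifting) sum.cong)
qed

lemma coord_add: "coord (x + y) b = coord x b + coord y b"
  using independent_bs span_bs by (simp add: representation_add)

lemma coord_scale: "coord (scale c x) b = c * coord x b"
  using independent_bs span_bs by (simp add: representation_scale)

lemma coord_sum: "coord (\<Sum>i\<in>I. f i) b = (\<Sum>i\<in>I. coord (f i) b)"
  using independent_bs span_bs by (simp add: representation_sum)

lemma coord_zero: "coord 0 b = 0"
  by (simp add: representation_zero)

lemma coord_mat_carrier: "coord_mat w \<in> carrier_mat (length bs) (length bs)"
  by (simp add: coord_mat_def)

text \<open>In coordinates this is the product of a matrix with its adjugate, so it holds even when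
  the determinant vanishes.\<close>

lemma cramer:
  "(\<Sum>j<length bs. scale (cramer_coeff w u j) (w j)) = scale (det (coord_mat w)) u"
proof (rule coord_eqI)
  fix b assume "b \<in> set bs"
  then obtain i where i: "i < length bs" "b = bs ! i"
    by (auto simp: in_set_conv_nth)
  let ?n = "length bs" and ?M = "coord_mat w"
  have entry: "(\<Sum>j<?n. coord (w j) b * adj_mat ?M $$ (j, k)) = (if i = k then det ?M else 0)"
    if k: "k < ?n" for k
  proof -
    have "(?M * adj_mat ?M) $$ (i, k) = (\<Sum>j<?n. coord (w j) b * adj_mat ?M $$ (j, k))"
      using i k adj_mat(1)[OF coord_mat_carrier[of w]]
      by (simp add: coord_mat_def scalar_prod_def atLeast0LessThan)
    then show ?thesis
      using i k by (cases "i = k") (simp_all add: adj_mat(2)[OF coord_mat_carrier])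
  qed
  have "coord (\<Sum>j<?n. scale (cramer_coeff w u j) (w j)) b =
      (\<Sum>j<?n. \<Sum>k<?n. adj_mat ?M $$ (j, k) * coord u (bs ! k) * coord (w j) b)"
    by (simp add: coord_sum coord_scale cramer_coeff_def sum_distrib_right)
  also have "\<dots> = (\<Sum>k<?n. \<Sum>j<?n. adj_mat ?M $$ (j, k) * coord u (bs ! k) * coord (w j) b)"
    by (rule sum.swap)
  also have "\<dots> = (\<Sum>k<?n. coord u (bs ! k) * (\<Sum>j<?n. coord (w j) b * adj_mat ?M $$ (j, k)))"
    by (simp add: sum_distrib_left mult_ac)
  also have "\<dots> = (\<Sum>k<?n. if i = k then coord u (bs ! k) * det ?M else 0)"
    by (intro sum.cong) (auto simp: entry)
  also have "\<dots> = coord (scale (det ?M) u) b"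
    using i by (simp add: coord_scale mult.commute)
  finally show "coord (\<Sum>j<?n. scale (cramer_coeff w u j) (w j)) b = coord (scale (det ?M) u) b" .
qed

text \<open>A nonzero kernel vector of the matrix would be a linear relation between the vectors
  \<open>w j\<close>. Injectivity enters because independence of the image set does not detect
  repetitions.\<close>

lemma det_coord_mat_nonzero:
  assumes ind: "independent (w ` {..<length bs})" and inj: "inj_on w {..<length bs}"
  shows "det (coord_mat w) \<noteq> 0"
proof
  let ?n = "length bs"
  assume "det (coord_mat w) = 0"
  then obtain x where x: "x \<in> carrier_vec ?n" "x \<noteq> 0\<^sub>v ?n" "coord_mat w *\<^sub>v x = 0\<^sub>v ?n"
    using det_0_iff_vec_prod_zero_field[OF coord_mat_carrier] by blast
  have "(\<Sum>j<?n. scale (x $ j) (w j)) = 0"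
  proof (rule coord_eqI)
    fix b assume "b \<in> set bs"
    then obtain i where i: "i < ?n" "b = bs ! i"
      by (auto simp: in_set_conv_nth)
    have "(coord_mat w *\<^sub>v x) $ i = (\<Sum>j<?n. coord (w j) b * x $ j)"
      using i x(1) by (simp add: coord_mat_def scalar_prod_def atLeast0LessThan)
    then have "(\<Sum>j<?n. coord (w j) b * x $ j) = 0"
      using i x(3) by simp
    then show "coord (\<Sum>j<?n. scale (x $ j) (w j)) b = coord 0 b"
      by (simp add: coord_sum coord_scale coord_zero mult.commute)
  qed
  \<comment> \<open>Independence speaks of sums over a set of vectors, so the relation is reindexed
    from positions to vectors.\<close>
  then have rel: "(\<Sum>y\<in>w ` {..<?n}. scale (x $ the_inv_into {..<?n} w y) y) = 0"
    by (simp add: sum.reindex[OF inj] the_inv_into_f_f[OF inj])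
  have "x $ j = 0" if "j < ?n" for j
  proof -
    have "x $ the_inv_into {..<?n} w (w j) = 0"
      by (rule independentD[OF ind _ order_refl rel]) (use that in auto)
    then show ?thesis using that by (simp add: the_inv_into_f_f[OF inj])
  qed
  then have "x = 0\<^sub>v ?n"
    using x(1) by (intro eq_vecI) auto
  with x(2) show False by simp
qed

text \<open>Expanding \<open>v\<close> in the basis makes each coordinate of \<open>f v\<close> a
  linear form in the coordinates of \<open>v\<close>.\<close>

lemma polyfuns_linear:
  assumes "Vector_Spaces.linear scale scale f"
  shows "(\<lambda>v. coord (f v) b) \<in> polyfuns (set bs)"
proof -
  interpret f: Vector_Spaces.linear scale scale f by fact
  have "coord (f v) b = (\<Sum>c\<in>set bs. coord v c * coord (f c) b)" for v
  proof -
    have "v = (\<Sum>c\<in>set bs. scale (coord v c) c)"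
      by (rule sum_representation_eq[symmetric]) (use independent_bs span_bs in auto)
    then have "f v = (\<Sum>c\<in>set bs. scale (coord v c) (f c))"
      by (metis (no_types, lifting) f.scale f.sum sum.cong)
    then show ?thesis by (simp add: coord_sum coord_scale)
  qed
  then have "(\<lambda>v. coord (f v) b) = (\<lambda>v. \<Sum>c\<in>set bs. coord v c * coord (f c) b)"
    by (rule ext)
  then show ?thesis
    by (simp add: polyfuns_sum polyfuns_mult polyfuns_coord polyfuns_const)
qed

lemma
  assumes w: "\<And>j b. j < length bs \<Longrightarrow> (\<lambda>v. coord (w v j) b) \<in> polyfuns (set bs)"
  shows polyfuns_det_coord_mat: "(\<lambda>v. det (coord_mat (w v))) \<in> polyfuns (set bs)"
    and polyfuns_cramer_coeff:
      "(\<And>b. (\<lambda>v. coord (u v) b) \<in> polyfuns (set bs)) \<Longrightarrow> j < length bs \<Longrightarrow>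
        (\<lambda>v. cramer_coeff (w v) (u v) j) \<in> polyfuns (set bs)"
proof -
  have entry: "(\<lambda>v. coord_mat (w v) $$ (i, j)) \<in> polyfuns (set bs)"
    if "i < length bs" "j < length bs" for i j
    using that by (simp add: coord_mat_def w)
  show "(\<lambda>v. det (coord_mat (w v))) \<in> polyfuns (set bs)"
    by (rule polyfuns_det[OF coord_mat_carrier entry])
  show "(\<lambda>v. cramer_coeff (w v) (u v) j) \<in> polyfuns (set bs)"
    if "\<And>b. (\<lambda>v. coord (u v) b) \<in> polyfuns (set bs)" "j < length bs"
    unfolding cramer_coeff_def
    by (intro polyfuns_sum polyfuns_mult polyfuns_adj_mat[OF coord_mat_carrier entry])
      (use that in auto)
qed

text \<open>Each vector equation splits into one polynomial equation per basis vector.\<close>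

lemma zariski_closed_equations:
  assumes f: "\<And>i b. i \<in> I \<Longrightarrow> (\<lambda>v. coord (f i v) b) \<in> polyfuns (set bs)"
    and h: "\<And>i b. i \<in> I \<Longrightarrow> (\<lambda>v. coord (h i v) b) \<in> polyfuns (set bs)"
  shows "zariski_closed {v. \<forall>i\<in>I. f i v = h i v}"
proof -
  let ?F = "(\<lambda>(i, b) v. coord (f i v) b - coord (h i v) b) ` (I \<times> set bs)"
  have "(\<lambda>v. coord (f i v) b - coord (h i v) b) \<in> polyfuns (set bs)" if "i \<in> I" for i b
    using polyfuns_add[OF f[OF that] polyfuns_mult[OF polyfuns_const[of "- 1"] h[OF that]]]
    by simp
  then have "?F \<subseteq> polyfuns (set bs)" by auto
  moreover have "{v. \<forall>i\<in>I. f i v = h i v} = {v. \<forall>q\<in>?F. q v = 0}"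
    by (auto intro: coord_eqI)
  ultimately show ?thesis
    unfolding zariski_closed_iff_polyfuns[OF finite_set independent_bs span_bs] by blast
qed

end

section \<open>Symmetries of a generator as solutions of polynomial equations\<close>

context group_module
begin

text \<open>Which tuples \<open>s\<close> give a basis depends on \<open>v\<close>, so the equations
  range over all tuples. They are necessary for every \<open>s\<close>, by applying \<open>A\<close>
  to \<open>cramer\<close>; for sufficiency one tuple giving a basis is enough.\<close>

lemma Sym_vec_eq_zero_set:
  assumes "ordered_basis_space scale bs"
    and \<pi>: "\<pi> permutes carrier G" and v: "v \<in> Gens"
  shows "\<pi> \<in> Sym_vec v \<longleftrightarrow>
    (\<forall>(s, g) \<in> ({..<length bs} \<rightarrow>\<^sub>E carrier G) \<times> carrier G.
      (\<Sum>j<length bs. scale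
          (ordered_basis_space.cramer_coeff scale bs (\<lambda>j. act (s j) v) (act g v) j)
          (act (\<pi> (s j)) v)) =
      scale (det (ordered_basis_space.coord_mat scale bs (\<lambda>j. act (s j) v))) (act (\<pi> g) v))"
    (is "_ \<longleftrightarrow> (\<forall>(s, g) \<in> ?S \<times> _. ?eq s g)")
proof -
  interpret ordered_basis_space scale bs by fact
  let ?n = "length bs"
  have span_orbit: "span (orbit G act v) = UNIV"
    using v by (simp add: Gens_def)
  show ?thesis
  proof
    assume "\<pi> \<in> Sym_vec v"
    then obtain A where A: "Vector_Spaces.linear scale scale A"
      and A\<pi>: "\<And>g. g \<in> carrier G \<Longrightarrow> A (act g v) = act (\<pi> g) v"
      unfolding Sym_vec_def GL_def by blast
    interpret A: Vector_Spaces.linear scale scale A by fact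
    have "?eq s g" if s: "s \<in> ?S" and g: "g \<in> carrier G" for s g
    proof -
      have "A (act (s j) v) = act (\<pi> (s j)) v" if "j < ?n" for j
        by (rule A\<pi>) (use s that in auto)
      then show ?thesis
        using arg_cong[OF cramer[of "\<lambda>j. act (s j) v" "act g v"], of A]
        by (simp add: A.sum A.scale A\<pi>[OF g])
    qed
    then show "\<forall>(s, g) \<in> ?S \<times> carrier G. ?eq s g" by blast
  next
    assume eq: "\<forall>(s, g) \<in> ?S \<times> carrier G. ?eq s g"
    interpret fin: finite_dimensional_vector_space scale "set bs"
      by unfold_locales (simp_all add: independent_bs span_bs)
    interpret pair: vector_space_pair scale scale ..
    obtain T where T: "T \<subseteq> orbit G act v" "independent T" "orbit G act v \<subseteq> span T"
      using maximal_independent_subset by blast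
    have "span T = UNIV"
      using T(3) span_orbit span_minimal[OF T(3) subspace_span] by blast
    then have card_T: "card T = ?n"
      using dim_eq_card[of T UNIV] dim_eq_card[of "set bs" UNIV] T(2) independent_bs span_bs
        distinct_bs by (simp add: distinct_card)
    moreover have "finite T"
      using T(2) by (rule fin.finiteI_independent)
    ultimately obtain t where t: "bij_betw t {..<?n} T"
      by (metis atLeast0LessThan ex_bij_betw_nat_finite)
    have "\<exists>g\<in>carrier G. act g v = t j" if "j < ?n" for j
    proof -
      have "t j \<in> orbit G act v" using bij_betwE[OF t] T(1) that by blast
      then show ?thesis by (auto simp: orbit_def)
    qed
    then obtain s0 where s0: "\<And>j. j < ?n \<Longrightarrow> s0 j \<in> carrier G \<and> act (s0 j) v = t j"
      by metis
    \<comment> \<open>The extensional function space \<open>?S\<close> fixes the value outside the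
      index range.\<close>
    define s where "s = restrict s0 {..<?n}"
    have s: "s \<in> ?S" and st: "\<And>j. j < ?n \<Longrightarrow> act (s j) v = t j"
      using s0 by (auto simp: s_def)
    let ?w = "\<lambda>j. act (s j) v"
    let ?D = "det (coord_mat ?w)"
    have inj: "inj_on ?w {..<?n}" and img: "?w ` {..<?n} = T"
      using t st by (auto simp: bij_betw_def inj_on_def image_def)
    have D: "?D \<noteq> 0"
      by (rule det_coord_mat_nonzero) (use inj img T(2) in auto)
    \<comment> \<open>\<open>A\<close> is prescribed on the basis \<open>T\<close> only; the inverse
      of \<open>?w\<close> recovers the position of a basis vector.\<close>
    define A where "A = pair.construct T (\<lambda>x. act (\<pi> (s (the_inv_into {..<?n} ?w x))) v)"
    have lin: "Vector_Spaces.linear scale scale A"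
      unfolding A_def by (rule pair.linear_construct[OF T(2)])
    interpret A: Vector_Spaces.linear scale scale A by (rule lin)
    have As: "A (?w j) = act (\<pi> (s j)) v" if "j < ?n" for j
    proof -
      have "?w j \<in> T" using img that by blast
      then show ?thesis
        using that by (simp add: A_def pair.construct_basis[OF T(2)] the_inv_into_f_f[OF inj])
    qed
    \<comment> \<open>The equations for this \<open>s\<close> carry the prescription over to the
      whole orbit, after cancelling the nonzero \<open>?D\<close>.\<close>
    have A\<pi>: "A (act g v) = act (\<pi> g) v" if g: "g \<in> carrier G" for g
    proof -
      have "scale ?D (A (act g v)) = (\<Sum>j<?n. scale (cramer_coeff ?w (act g v) j) (A (?w j)))"
        by (simp only: A.scale[symmetric] cramer[symmetric] A.sum)
      also have "\<dots> = scale ?D (act (\<pi> g) v)"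
        using eq s g by (auto simp: As)
      finally show ?thesis using D by (simp add: scale_left_imp_eq)
    qed
    \<comment> \<open>Since \<open>\<pi>\<close> is onto, the range of \<open>A\<close> contains the
      spanning orbit; bijectivity then follows from finite dimension.\<close>
    have "orbit G act v \<subseteq> A ` span (orbit G act v)"
    proof
      fix x assume "x \<in> orbit G act v"
      then obtain g where g: "g \<in> carrier G" "x = act g v" by (auto simp: orbit_def)
      obtain h where "h \<in> carrier G" "\<pi> h = g"
        using permutes_image[OF \<pi>] g(1) by (metis imageE)
      then have "x = A (act h v)" by (simp add: g A\<pi>)
      then show "x \<in> A ` span (orbit G act v)" by (simp add: span_orbit)
    qed
    then have "span (orbit G act v) \<subseteq> A ` span (orbit G act v)"
      by (intro span_minimal A.subspace_image subspace_span)
    then have "surj A" by (auto simp: span_orbit)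
    moreover from lin this have "inj A" by (rule fin.linear_surj_imp_inj)
    ultimately show "\<pi> \<in> Sym_vec v"
      using \<pi> lin A\<pi> unfolding Sym_vec_def GL_def bij_def by blast
  qed
qed

text \<open>The equations make sense at every vector, so their solutions form a closed set of the
  whole space, which describes the symmetry condition on \<open>Gens\<close>.\<close>

lemma Sym_vec_zariski_closed:
  assumes "ordered_basis_space scale bs" and \<pi>: "\<pi> permutes carrier G"
  obtains C where "zariski_closed C" "\<And>v. v \<in> Gens \<Longrightarrow> \<pi> \<in> Sym_vec v \<longleftrightarrow> v \<in> C"
proof -
  interpret ordered_basis_space scale bs by fact
  \<comment> \<open>Tuple and group element are packed into a single index, as
    \<open>zariski_closed_equations\<close> expects.\<close>
  define C where "C = {v. \<forall>i \<in> ({..<length bs} \<rightarrow>\<^sub>E carrier G) \<times> carrier G.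
      (\<Sum>j<length bs. scale (cramer_coeff (\<lambda>j. act (fst i j) v) (act (snd i) v) j)
        (act (\<pi> (fst i j)) v)) =
      scale (det (coord_mat (\<lambda>j. act (fst i j) v))) (act (\<pi> (snd i)) v)}"
  have "zariski_closed C"
    unfolding C_def
  proof (rule zariski_closed_equations; clarsimp simp: coord_sum coord_scale)
    fix s g b assume s: "s \<in> {..<length bs} \<rightarrow>\<^sub>E carrier G" and g: "g \<in> carrier G"
    have act: "(\<lambda>v. coord (act h v) c) \<in> polyfuns (set bs)" if "h \<in> carrier G" for h c
      by (rule polyfuns_linear[OF linear_act[OF that]])
    have \<pi>_in: "\<pi> h \<in> carrier G" if "h \<in> carrier G" for h
      using permutes_in_image[OF \<pi>] that by simp
    have s_in: "s j \<in> carrier G" if "j < length bs" for j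
      using s that by auto
    show "(\<lambda>v. \<Sum>j<length bs. cramer_coeff (\<lambda>j. act (s j) v) (act g v) j *
        coord (act (\<pi> (s j)) v) b) \<in> polyfuns (set bs)"
      by (intro polyfuns_sum polyfuns_mult polyfuns_cramer_coeff act \<pi>_in s_in g) auto
    show "(\<lambda>v. det (coord_mat (\<lambda>j. act (s j) v)) * coord (act (\<pi> g) v) b) \<in> polyfuns (set bs)"
      by (intro polyfuns_mult polyfuns_det_coord_mat act \<pi>_in s_in g)
  qed
  moreover have "\<pi> \<in> Sym_vec v \<longleftrightarrow> v \<in> C" if "v \<in> Gens" for v
    unfolding Sym_vec_eq_zero_set[OF assms that] by (auto simp: C_def)
  ultimately show ?thesis by (rule that)
qed

end

section \<open>Closedness of the exceptional generators\<close>

theorem theorem1: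
  fixes G :: "('g, 'm) monoid_scheme"
    and scale :: "'k::field \<Rightarrow> 'v::ab_group_add \<Rightarrow> 'v"
    and act :: "'g \<Rightarrow> 'v \<Rightarrow> 'v"
  assumes "infinite (UNIV :: 'k set)"
    and "finite (carrier G)"
    and "group_module G scale act"
    and "group_module.cyclic G scale act"
  shows "closedin
    (subtopology (zariski_space.zariski_topology scale) (group_module.Gens G scale act))
    {v \<in> group_module.Gens G scale act.
      group_module.Sym_vec G scale act v \<noteq> group_module.Sym_mod G scale act}"
proof -
  interpret group_module G scale act by fact
  obtain u where u: "span (orbit G act u) = UNIV"
    using assms(4) by (auto simp: cyclic_def Gens_def)
  have "orbit G act u = (\<lambda>g. act g u) ` carrier G"
    by (auto simp: orbit_def)
  \<comment> \<open>Cyclicity makes the space finite-dimensional: a finite orbit spans it and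
    therefore contains a finite basis.\<close>
  then have "finite (orbit G act u)" using assms(2) by simp
  moreover obtain B where B: "B \<subseteq> orbit G act u" "independent B" "orbit G act u \<subseteq> span B"
    using maximal_independent_subset by blast
  ultimately have "finite B" using finite_subset by blast
  then obtain bs where bs: "set bs = B" "distinct bs"
    using finite_distinct_list by blast
  have "span B = UNIV"
    using u span_minimal[OF B(3) subspace_span] by blast
  with B(2) bs have basis: "ordered_basis_space scale bs"
    by unfold_locales auto
  note B_basis = \<open>finite B\<close> \<open>independent B\<close> \<open>span B = UNIV\<close>
  have "\<exists>C. zariski_closed C \<and> (\<forall>v\<in>Gens. \<pi> \<in> Sym_vec v \<longleftrightarrow> v \<in> C)" if "\<pi> permutes carrier G" for \<pi>
    using Sym_vec_zariski_closed[OF basis that] by metis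
  then obtain C where C: "\<And>\<pi>. \<pi> permutes carrier G \<Longrightarrow> zariski_closed (C \<pi>)"
    "\<And>\<pi> v. \<pi> permutes carrier G \<Longrightarrow> v \<in> Gens \<Longrightarrow> \<pi> \<in> Sym_vec v \<longleftrightarrow> v \<in> C \<pi>"
    by metis
  define P where "P = {\<pi>. \<pi> permutes carrier G} - Sym_mod"
  have "finite P"
    using finite_permutations[OF assms(2)] by (simp add: P_def)
  then have "closedin zariski_topology (\<Union>\<pi>\<in>P. C \<pi>)"
    by (intro closedin_Union) (auto simp: closedin_zariski_topology[OF B_basis] P_def C(1))
  moreover have "{v \<in> Gens. Sym_vec v \<noteq> Sym_mod} = (\<Union>\<pi>\<in>P. C \<pi>) \<inter> Gens"
  proof -
    \<comment> \<open>As \<open>Sym_mod\<close> is contained in \<open>Sym_vec v\<close>, the two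
      differ exactly when \<open>Sym_vec v\<close> has an element in \<open>P\<close>.\<close>
    have "Sym_vec v \<noteq> Sym_mod \<longleftrightarrow> (\<exists>\<pi>\<in>P. v \<in> C \<pi>)" if v: "v \<in> Gens" for v
    proof -
      have "Sym_mod \<subseteq> Sym_vec v"
        using v by (auto simp: Sym_mod_def)
      moreover have "Sym_vec v \<subseteq> {\<pi>. \<pi> permutes carrier G}"
        by (auto simp: Sym_vec_def)
      ultimately show ?thesis
        using C(2)[OF _ v] unfolding P_def by blast
    qed
    then show ?thesis by blast
  qed
  ultimately show ?thesis
    unfolding closedin_subtopology by blast
qed

end
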